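(* Let $c>\frac12$ and let $f:\mathbb{R}\to\mathbb{R}$ be given by $f(x)=1$ if $x\in(-1,0)$ and $f(x)=0$ otherwise. Then there is a function $N:\mathbb{R}\to\mathbb{R}_{\ge 0}$ such that $\mathrm{Lip}(N)=c$ and $$\mathcal{V}(M^1_N f) = +\infty .$$
   Context: For $N:\mathbb{R}\to\mathbb{R}_{\ge 0}$ and $f:\mathbb{R}\to\mathbb{R}$ locally integrable, the $N$-truncated uncentered maximal function is $$M^1_N f(x) = \sup_{(y,t):\ t>0,\ |x-y|\le t\le N(x)} \frac{1}{2t}\int_{y-t}^{y+t} |f(s)|\,ds ,$$ with the convention $M^1_N f(x)=|f(x)|$ at points where $N(x)=0$. The Lipschitz constant is $\mathrm{Lip}(N) = \sup_{x\ne y} \frac{|N(x)-N(y)|}{|x-y|}$. The total variation of $g:\mathbb{R}\to\mathbb{R}$ is $\mathcal{V}(g) = \sup \sum_{i=1}^{n-1} |g(x_{i+1})-g(x_i)|$ over all finite sequences $x_1<\dots<x_n$. *)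

theory Defs
  imports "HOL-Analysis.Analysis"
begin

text \<open>The supremum is taken in the extended reals, since it may be infinite for an unbounded locally
  integrable \<open>f\<close>.\<close>

definition truncated_maximal :: "(real \<Rightarrow> real) \<Rightarrow> (real \<Rightarrow> real) \<Rightarrow> real \<Rightarrow> ereal" where
  "truncated_maximal N f x =
     (if N x = 0 then ereal \<bar>f x\<bar>
      else (SUP (y, t) \<in> {(y, t). t > 0 \<and> \<bar>x - y\<bar> \<le> t \<and> t \<le> N x}.
              ereal (1 / (2 * t) * (LINT s:{y - t..y + t}|lebesgue. \<bar>f s\<bar>))))"

definition Lip :: "(real \<Rightarrow> real) \<Rightarrow> ereal" where
  "Lip N = (SUP (x, y) \<in> {(x, y). x \<noteq> y}. ereal (\<bar>N x - N y\<bar> / \<bar>x - y\<bar>))"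

definition total_variation :: "(real \<Rightarrow> real) \<Rightarrow> ereal" where
  "total_variation g =
     (SUP xs \<in> {xs. xs \<noteq> [] \<and> sorted_wrt (<) xs}.
        ereal (\<Sum>i<length xs - 1. \<bar>g (xs ! Suc i) - g (xs ! i)\<bar>))"

text \<open>For bounded \<open>f\<close> the maximal function is finite, so composing it with
  \<^const>\<open>real_of_ereal\<close> loses no information.\<close>

lemma truncated_maximal_bounded:
  assumes B: "\<And>x. \<bar>f x\<bar> \<le> B" and N: "N x \<ge> 0"
  shows "0 \<le> truncated_maximal N f x" and "truncated_maximal N f x \<le> ereal B"
proof -
  let ?I = "\<lambda>y t. LINT s:{y - t..y + t}|lebesgue. \<bar>f s\<bar>"
  have B0: "B \<ge> 0" using B[of 0] by linarith
  have nonneg: "?I y t \<ge> 0" for y t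
    unfolding set_lebesgue_integral_def by (rule integral_nonneg_AE) auto
  have le: "?I y t \<le> 2 * t * B" if "t > 0" for y t
  proof (cases "set_integrable lebesgue {y - t..y + t} (\<lambda>s. \<bar>f s\<bar>)")
    case True
    have c: "set_integrable lebesgue {y - t..y + t} (\<lambda>s. B)"
      unfolding set_integrable_def by (intro integrable_scaleR_left integrable_real_indicator)
        (auto simp: emeasure_lborel_Icc_eq)
    have "?I y t \<le> (LINT s:{y - t..y + t}|lebesgue. B)"
      by (rule set_integral_mono[OF True c]) (use B in auto)
    also have "\<dots> = 2 * t * B"
      using that by (subst set_integral_const) auto
    finally show ?thesis .
  next
    case False
    then have "?I y t = 0"
      unfolding set_integrable_def set_lebesgue_integral_def by (rule not_integrable_integral_eq)
    with that B0 show ?thesis by simp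
  qed
  show "0 \<le> truncated_maximal N f x"
  proof (cases "N x = 0")
    case False
    with N have "N x > 0" by simp
    then have "0 \<le> ereal (1 / (2 * N x) * ?I x (N x))"
      using nonneg by simp
    also have "\<dots> \<le> truncated_maximal N f x"
      unfolding truncated_maximal_def using False \<open>N x > 0\<close>
      by (auto intro!: SUP_upper2[where i = "(x, N x)"])
    finally show ?thesis .
  qed (simp add: truncated_maximal_def)
  have "1 / (2 * t) * ?I y t \<le> B" if "t > 0" for y t
    using le[OF that, of y] that by (simp add: divide_le_eq mult.commute)
  then show "truncated_maximal N f x \<le> ereal B"
    unfolding truncated_maximal_def using B
    by (auto intro!: SUP_least simp del: times_divide_eq_left)
qed

end

theory Submission
  imports Defs
begin

text \<open>For \<open>x > 0\<close> the maximal function of the indicator of \<open>(-1, 0)\<close> vanishes as soon as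
  \<open>N x \<le> x / 2\<close>, whereas \<open>N x = b x\<close> with a fixed \<open>b > 1 / 2\<close> makes it at least
  \<open>1 - 1 / (2 b)\<close> for small \<open>x\<close>. The function \<open>x (1 / 2 + e (1 + sin (ln x)))\<close> oscillates
  between these two regimes infinitely often as \<open>x\<close> decreases to \<open>0\<close>, and its derivative
  \<open>1 / 2 + e (1 + sin (ln x) + cos (ln x))\<close> is bounded by \<open>c\<close> once \<open>e\<close> is small.
  Slope \<open>-c\<close> on the negative half line makes the Lipschitz constant exactly \<open>c\<close>.\<close>

text \<open>The first \<open>m\<close> jumps alone contribute at least \<open>m * \<delta>\<close>,
  which is unbounded in \<open>m\<close>. The points decrease because the lemma serves oscillations
  accumulating at \<open>0\<close> from the right.\<close>

lemma total_variation_eq_PInfty: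
  fixes g :: "real \<Rightarrow> real" and p :: "nat \<Rightarrow> real"
  assumes p: "\<And>k. p (Suc k) < p k" and "\<delta> > 0"
    and osc: "\<And>k. \<bar>g (p k) - g (p (Suc k))\<bar> \<ge> \<delta>"
  shows "total_variation g = \<infinity>"
  unfolding total_variation_def
proof (rule SUP_PInfty)
  fix n :: nat
  obtain m :: nat where m: "real n / \<delta> \<le> real m"
    using real_arch_simple by blast
  \<comment> \<open>The variation sums run over increasing lists, so \<open>p 0\<close>, ...,
    \<open>p m\<close> are listed in reverse.\<close>
  define xs where "xs = map (\<lambda>i. p (m - i)) [0..<Suc m]"
  have len: "length xs = Suc m" by (simp add: xs_def)
  have nth: "xs ! i = p (m - i)" if "i \<le> m" for i
    using that unfolding xs_def by (subst nth_map) (auto simp del: upt_Suc)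
  have anti: "p j < p i" if "i < j" for i j
    using that p by (rule lift_Suc_mono_less[where f = "\<lambda>k. - p k", simplified, rotated])
  have "sorted_wrt (<) xs"
    unfolding sorted_wrt_iff_nth_less using nth anti len by auto
  moreover have "xs \<noteq> []" using len by auto
  moreover have "real n \<le> (\<Sum>i<length xs - 1. \<bar>g (xs ! Suc i) - g (xs ! i)\<bar>)"
  proof -
    have "real n \<le> (\<Sum>i<m. \<delta>)"
      using m \<open>\<delta> > 0\<close> by (simp add: divide_le_eq)
    also have "\<dots> \<le> (\<Sum>i<m. \<bar>g (xs ! Suc i) - g (xs ! i)\<bar>)"
    proof (rule sum_mono)
      fix i assume "i \<in> {..<m}"
      then have "xs ! i = p (Suc (m - Suc i))" "xs ! Suc i = p (m - Suc i)"
        using nth[of i] nth[of "Suc i"] by (auto simp: Suc_diff_Suc)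
      then show "\<delta> \<le> \<bar>g (xs ! Suc i) - g (xs ! i)\<bar>"
        using osc[of "m - Suc i"] by simp
    qed
    finally show ?thesis using len by simp
  qed
  ultimately show "\<exists>xs\<in>{xs. xs \<noteq> [] \<and> sorted_wrt (<) xs}.
      ereal (real n) \<le> ereal (\<Sum>i<length xs - 1. \<bar>g (xs ! Suc i) - g (xs ! i)\<bar>)"
    by auto
qed

lemma Lip_eqI:
  assumes "\<And>x y. x \<noteq> y \<Longrightarrow> \<bar>N x - N y\<bar> \<le> c * \<bar>x - y\<bar>"
    and "a \<noteq> b" and "\<bar>N a - N b\<bar> = c * \<bar>a - b\<bar>"
  shows "Lip N = ereal c"
  unfolding Lip_def
proof (rule antisym)
  show "(SUP (x, y) \<in> {(x, y). x \<noteq> y}. ereal (\<bar>N x - N y\<bar> / \<bar>x - y\<bar>)) \<le> ereal c"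
    using assms(1) by (auto intro!: SUP_least simp: divide_le_eq)
  show "ereal c \<le> (SUP (x, y) \<in> {(x, y). x \<noteq> y}. ereal (\<bar>N x - N y\<bar> / \<bar>x - y\<bar>))"
    using assms(2,3) by (auto intro!: SUP_upper2[where i = "(a, b)"])
qed

text \<open>Every admissible interval starts at
  \<open>y - t \<ge> x - 2 * t \<ge> x - 2 * N x \<ge> 0\<close>, so it misses the negative half
  line.\<close>

lemma truncated_maximal_eq_0:
  assumes f: "\<And>s. s \<ge> 0 \<Longrightarrow> f s = 0" and N: "0 \<le> N x" "2 * N x \<le> x"
  shows "truncated_maximal N f x = 0"
proof (rule antisym)
  have "(LINT s:{y - t..y + t}|lebesgue. \<bar>f s\<bar>) = 0"
    if "\<bar>x - y\<bar> \<le> t" "t \<le> N x" for y t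
  proof -
    have "indicator {y - t..y + t} s *\<^sub>R \<bar>f s\<bar> = 0" for s :: real
      using that N f[of s] by (auto simp: indicator_def)
    then show ?thesis unfolding set_lebesgue_integral_def by (simp only: integral_zero)
  qed
  moreover have "f x = 0" using f[of x] N by simp
  ultimately show "truncated_maximal N f x \<le> 0"
    unfolding truncated_maximal_def by (auto intro!: SUP_least)
  have "ereal 0 \<le> ereal (1 / (2 * N x) * (LINT s:{x - N x..x + N x}|lebesgue. \<bar>f s\<bar>))"
    using N unfolding set_lebesgue_integral_def
    by (auto intro!: mult_nonneg_nonneg integral_nonneg_AE)
  then show "0 \<le> truncated_maximal N f x"
    unfolding truncated_maximal_def using N
    by (auto intro!: SUP_upper2[where i = "(x, N x)"] simp: zero_ereal_def)
qed

lemma average_le_truncated_maximal: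
  assumes "t > 0" "\<bar>x - y\<bar> \<le> t" "t \<le> N x"
  shows "ereal (1 / (2 * t) * (LINT s:{y - t..y + t}|lebesgue. \<bar>f s\<bar>)) \<le> truncated_maximal N f x"
  unfolding truncated_maximal_def using assms
  by (auto intro!: SUP_upper2[where i = "(y, t)"])

text \<open>Test with the longest admissible interval having right endpoint \<open>x\<close>, namely
  from \<open>x - 2 * N x\<close> to \<open>x\<close>. Its left endpoint lies above
  \<open>-1\<close>, so exactly a length \<open>2 * N x - x\<close> of it falls where
  \<open>f\<close> is \<open>1\<close>.\<close>

lemma truncated_maximal_ge:
  fixes f :: "real \<Rightarrow> real"
  assumes f: "\<And>s. f s = (if s \<in> {-1<..<0} then 1 else 0)"
    and x: "0 < x" "x \<le> 2 * N x" "2 * N x < 1 + x"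
  shows "ereal (1 - x / (2 * N x)) \<le> truncated_maximal N f x"
proof -
  let ?t = "N x"
  have "(LINT s:{x - ?t - ?t..x - ?t + ?t}|lebesgue. \<bar>f s\<bar>)
      = (LINT s|lebesgue. indicator {x - 2 * ?t..<0} s)"
    unfolding set_lebesgue_integral_def
    using x f by (intro Bochner_Integration.integral_cong) (auto simp: indicator_def)
  also have "\<dots> = 2 * ?t - x"
    using x by simp
  finally have "1 / (2 * ?t) * (LINT s:{x - ?t - ?t..x - ?t + ?t}|lebesgue. \<bar>f s\<bar>)
      = 1 - x / (2 * ?t)"
    using x by (simp add: field_simps)
  then show ?thesis
    using average_le_truncated_maximal[where x = x and y = "x - ?t" and t = ?t and N = N and f = f] x
    by simp
qed

theorem theorem4:
  fixes c :: real and f :: "real \<Rightarrow> real"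
  assumes "c > 1 / 2"
    and "\<And>x. f x = (if x \<in> {-1<..<0} then 1 else 0)"
  shows "\<exists>N :: real \<Rightarrow> real.
           (\<forall>x. N x \<ge> 0) \<and> Lip N = ereal c \<and>
           total_variation (\<lambda>x. real_of_ereal (truncated_maximal N f x)) = \<infinity>"
proof -
  \<comment> \<open>The first bound absorbs \<open>\<bar>1 + sin + cos\<bar> \<le> 3\<close> in the
    derivative of \<open>h\<close>; the second keeps the test intervals at the peaks to the right of
    \<open>-1\<close>.\<close>
  define e where "e = min ((c - 1 / 2) / 3) (1 / 4)"
  have e: "e > 0" "3 * e \<le> c - 1 / 2" "e \<le> 1 / 4"
    using assms(1) by (auto simp: e_def min_def)
  define h where "h x = x * (1 / 2 + e * (1 + sin (ln x)))" for x
  define N where "N x = (if x > 0 then h x else - c * x)" for x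
  have h_bounds: "0 \<le> h x" "h x \<le> c * x" if "x > 0" for x
  proof -
    have "0 \<le> e * (1 + sin (ln x))" "e * (1 + sin (ln x)) \<le> e * 2"
      using e(1) sin_ge_minus_one[of "ln x"] sin_le_one[of "ln x"]
      by (intro mult_nonneg_nonneg mult_left_mono; linarith)+
    then have "0 \<le> 1 / 2 + e * (1 + sin (ln x))" "1 / 2 + e * (1 + sin (ln x)) \<le> c"
      using e by linarith+
    then show "0 \<le> h x" "h x \<le> c * x"
      using that unfolding h_def by (auto simp: mult.commute intro: mult_right_mono)
  qed
  have h_lip: "\<bar>h y - h x\<bar> \<le> c * (y - x)" if "0 < x" "x < y" for x y
  proof -
    define D where "D z = 1 / 2 + e * (1 + sin (ln z) + cos (ln z))" for z
    have "(h has_real_derivative D z) (at z)" if "z > 0" for z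
      unfolding h_def D_def using that
      by (auto intro!: derivative_eq_intros simp: algebra_simps)
    then obtain z where z: "h y - h x = (y - x) * D z"
      using MVT2[of x y h D] \<open>0 < x\<close> \<open>x < y\<close> by (metis less_le_trans)
    have "\<bar>e * (1 + sin (ln z) + cos (ln z))\<bar> \<le> e * 3"
      unfolding abs_mult using e(1) abs_sin_le_one[of "ln z"] abs_cos_le_one[of "ln z"]
      by (intro mult_mono; linarith)
    then have "\<bar>D z\<bar> \<le> c" unfolding D_def using e by linarith
    then show ?thesis using z that by (simp add: abs_mult mult.commute mult_left_mono)
  qed
  have N_nonneg: "N x \<ge> 0" for x
    using h_bounds[of x] assms(1) by (auto simp: N_def mult_nonneg_nonpos)
  have N_lip: "\<bar>N y - N x\<bar> \<le> c * (y - x)" if "x < y" for x y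
  proof (cases "x > 0 \<or> y \<le> 0")
    case True
    then show ?thesis
    proof
      assume "y \<le> 0"
      moreover have "\<bar>c * (y - x)\<bar> = c * (y - x)" using assms(1) that by simp
      ultimately show ?thesis using that by (simp add: N_def algebra_simps)
    qed (use that h_lip in \<open>simp add: N_def\<close>)
  next
    case False
    \<comment> \<open>Across \<open>0\<close>, both values are nonnegative, with
      \<open>N y \<le> c * y\<close> and \<open>N x = c * (- x)\<close>, so their difference is at
      most the sum \<open>c * (y - x)\<close>.\<close>
    then have "N y = h y" "N x = c * (- x)" "0 \<le> c * y" "0 \<le> c * (- x)"
      using assms(1) by (auto simp: N_def mult_nonneg_nonpos)
    then show ?thesis
      using h_bounds[of y] False by (simp add: algebra_simps)
  qed
  have "Lip N = ereal c"
  proof (rule Lip_eqI)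
    show "\<bar>N x - N y\<bar> \<le> c * \<bar>x - y\<bar>" if "x \<noteq> y" for x y
      using that N_lip[of x y] N_lip[of y x] by (cases x y rule: linorder_cases) auto
    show "\<bar>N (-1) - N 0\<bar> = c * \<bar>-1 - 0\<bar>"
      using assms(1) by (simp add: N_def)
  qed auto
  moreover have "total_variation (\<lambda>x. real_of_ereal (truncated_maximal N f x)) = \<infinity>"
  proof -
    let ?M = "\<lambda>x. real_of_ereal (truncated_maximal N f x)"
    \<comment> \<open>This is \<open>1 - x / (2 * N x)\<close> at a peak, where
      \<open>sin (ln x) = 1\<close> and hence \<open>2 * N x = (1 + 4 * e) * x\<close>.\<close>
    define \<delta> where "\<delta> = 1 - 1 / (1 + 4 * e)"
    \<comment> \<open>At these points \<open>sin (ln x)\<close> is alternately \<open>-1\<close>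
      (even \<open>k\<close>) and \<open>1\<close> (odd \<open>k\<close>).\<close>
    define p where "p k = exp (- (pi / 2) - real k * pi)" for k
    have p_pos: "p k > 0" for k by (simp add: p_def)
    have sin_p: "sin (ln (p k)) = - ((-1) ^ k)" for k
      by (simp add: p_def sin_diff cos_npi)
    have even: "?M (p k) = 0" if "even k" for k
    proof -
      have "N (p k) = p k / 2"
        using p_pos[of k] sin_p[of k] that by (simp add: N_def h_def)
      then have "truncated_maximal N f (p k) = 0"
        using p_pos[of k] assms(2) by (intro truncated_maximal_eq_0) auto
      then show ?thesis by simp
    qed
    have odd: "?M (p k) \<ge> \<delta>" if "odd k" for k
    proof -
      have N_p: "2 * N (p k) = (1 + 4 * e) * p k"
        using p_pos[of k] sin_p[of k] that by (simp add: N_def h_def algebra_simps)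
      \<comment> \<open>With \<open>p k < 1\<close> this gives
        \<open>(1 + 4 * e) * p k \<le> 2 * p k < 1 + p k\<close>.\<close>
      have "4 * e * p k \<le> 1 * p k" using e p_pos[of k] by (intro mult_right_mono) auto
      moreover have "0 < e * p k" using e p_pos[of k] by simp
      moreover have "p k < 1"
        unfolding p_def exp_less_one_iff
        using pi_gt_zero mult_nonneg_nonneg[of "real k" pi] by linarith
      ultimately have "p k \<le> 2 * N (p k)" "2 * N (p k) < 1 + p k"
        unfolding N_p distrib_right by linarith+
      then have "ereal (1 - p k / (2 * N (p k))) \<le> truncated_maximal N f (p k)"
        using p_pos[of k] assms(2) by (intro truncated_maximal_ge)
      moreover have "1 - p k / (2 * N (p k)) = \<delta>"
        unfolding N_p \<delta>_def using p_pos[of k] by simp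
      \<comment> \<open>Finiteness matters: \<open>real_of_ereal\<close> sends
        \<open>\<infinity>\<close> to \<open>0\<close>, which would destroy the lower bound.\<close>
      moreover have "truncated_maximal N f (p k) \<le> ereal 1"
        by (rule truncated_maximal_bounded) (use assms(2) N_nonneg in auto)
      ultimately show ?thesis
        by (cases "truncated_maximal N f (p k)") auto
    qed
    show ?thesis
    proof (rule total_variation_eq_PInfty)
      show "p (Suc k) < p k" for k by (simp add: p_def algebra_simps)
      show "\<delta> > 0" using e by (simp add: \<delta>_def)
      show "\<delta> \<le> \<bar>?M (p k) - ?M (p (Suc k))\<bar>" for k
      proof (cases "even k")
        case True
        then show ?thesis using even[of k] odd[of "Suc k"] by (simp del: abs_real_of_ereal)
      next
        case False
        then show ?thesis using odd[of k] even[of "Suc k"] by (simp del: abs_real_of_ereal)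
      qed
    qed
  qed
  ultimately show ?thesis using N_nonneg by blast
qed

end
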